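(* Let $n\ge1$ and let $G_n$ be the graph defined below. Let $S$ be a dominating set of $G_n$ of size at most $\gamma(G_n)+1$ such that every ladder of $G_n$ is in state $S_1$, and let $T$ be a dominating set of $G_n$ of size at most $\gamma(G_n)+1$ such that every ladder of $G_n$ is in state $S_7$. Then every reconfiguration sequence between $S$ and $T$ in $D_{\gamma(G_n)+1}(G_n)$ has length at least $12(2^{n+1}-n-2)$.
   Context: A set $S\subseteq V(G)$ is a dominating set of $G$ if every vertex of $V(G)\setminus S$ is adjacent to a vertex of $S$; $\gamma(G)$ is the minimum cardinality of a dominating set. For a positive integer $k$, $D_k(G)$ has as vertices the dominating sets of $G$ of cardinality at most $k$, two being adjacent iff their symmetric difference is exactly one vertex; a reconfiguration sequence is a walk in $D_k(G)$ and its length is its number of edges. Linking two vertices $x,y$ by a linkage gadget means adding the edge $\{x,y\}$ and three new vertices each adjacent exactly to $x$ and $y$. A ladder $L_j$ has ladder vertices $\ell_{j,1},\dots,\ell_{j,6},r_{j,1},\dots,r_{j,6}$ and a separate linkage gadget linking each of the fifteen pairs $\{\ell_{j,i},\ell_{j,i+1}\}$, $\{r_{j,i},r_{j,i+1}\}$, $\{\ell_{j,i+1},r_{j,i}\}$ ($1\le i\le5$); $V(L_j)$ consists of these $12$ ladder vertices and the $45$ internal vertices. $G_n$ consists of disjoint ladders $L_1,\dots,L_n$ plus, for each $1\le j\le n-1$, six gluing vertices $g_{j,1},\dots,g_{j,6}$ with edges $\{\ell_{j,1},g_{j,1}\},\{\ell_{j,1},g_{j,2}\},\{r_{j,2},g_{j,1}\},\{r_{j,2},g_{j,2}\},\{\ell_{j+1,6},g_{j,1}\},\{r_{j+1,6},g_{j,2}\}$;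 $\{\ell_{j,3},g_{j,3}\},\{\ell_{j,3},g_{j,4}\},\{r_{j,4},g_{j,3}\},\{r_{j,4},g_{j,4}\},\{\ell_{j+1,1},g_{j,3}\},\{r_{j+1,1},g_{j,4}\}$; $\{\ell_{j,5},g_{j,5}\},\{\ell_{j,5},g_{j,6}\},\{r_{j,6},g_{j,5}\},\{r_{j,6},g_{j,6}\},\{\ell_{j+1,6},g_{j,5}\},\{r_{j+1,6},g_{j,6}\}$. For a set $X\subseteq V(G_n)$, ladder $L_j$ is in state $S_1$ if $X\cap V(L_j)=\{\ell_{j,1},\ell_{j,3},\ell_{j,5},r_{j,1},r_{j,3},r_{j,5}\}$, and in state $S_7$ if $X\cap V(L_j)=\{\ell_{j,2},\ell_{j,4},\ell_{j,6},r_{j,2},r_{j,4},r_{j,6}\}$. *)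

theory Defs
  imports "Graph_Theory.Graph_Theory"
begin

definition dominating_set :: "('a, 'b) pre_digraph \<Rightarrow> 'a set \<Rightarrow> bool" where
  "dominating_set G S \<longleftrightarrow>
     S \<subseteq> verts G \<and> (\<forall>v \<in> verts G - S. \<exists>u\<in>S. v \<rightarrow>\<^bsub>G\<^esub> u)"

(* Meaningful for graphs with finitely many vertices only, because of Min and card. *)
definition domination_number :: "('a, 'b) pre_digraph \<Rightarrow> nat" where
  "domination_number G = Min (card ` {S. dominating_set G S})"

definition reconf_graph :: "nat \<Rightarrow> ('a, 'b) pre_digraph \<Rightarrow> 'a set pair_pre_digraph" where
  "reconf_graph k G =
     (let D = {S. dominating_set G S \<and> card S \<le> k}
      in \<lparr>pverts = D, parcs = {(A, B) \<in> D \<times> D. card (sym_diff A B) = 1}\<rparr>)"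

definition reconf_sequence ::
  "nat \<Rightarrow> ('a, 'b) pre_digraph \<Rightarrow> 'a set \<Rightarrow> 'a set vwalk \<Rightarrow> 'a set \<Rightarrow> bool" where
  "reconf_sequence k G S p T \<longleftrightarrow> vwalk p (reconf_graph k G) \<and> hd p = S \<and> last p = T"

(* Left j i, Right j i and Glue j i are the vertices l_{j,i}, r_{j,i} and g_{j,i}.
   Internal x y m with m = 1, 2, 3 are the new vertices of the gadget linking x and y;
   indexing them by the pair itself keeps distinct gadgets disjoint. *)
datatype vertex =
    Left nat nat
  | Right nat nat
  | Internal vertex vertex nat
  | Glue nat nat

definition gadget_verts :: "vertex \<Rightarrow> vertex \<Rightarrow> vertex set" where
  "gadget_verts x y = Internal x y ` {1..3}"

(* This and all other edge sets below list each edge in one direction only. *)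
definition gadget_edges :: "vertex \<Rightarrow> vertex \<Rightarrow> vertex rel" where
  "gadget_edges x y = insert (x, y) (\<Union>z\<in>gadget_verts x y. {(x, z), (y, z)})"

definition linked_pairs :: "nat \<Rightarrow> vertex rel" where
  "linked_pairs j =
     (\<Union>i\<in>{1..5}. {(Left j i, Left j (i + 1)), (Right j i, Right j (i + 1)),
                     (Left j (i + 1), Right j i)})"

definition ladder_verts :: "nat \<Rightarrow> vertex set" where
  "ladder_verts j =
     Left j ` {1..6} \<union> Right j ` {1..6} \<union> (\<Union>(x, y)\<in>linked_pairs j. gadget_verts x y)"

definition ladder_edges :: "nat \<Rightarrow> vertex rel" where
  "ladder_edges j = (\<Union>(x, y)\<in>linked_pairs j. gadget_edges x y)"

definition glue_verts :: "nat \<Rightarrow> vertex set" where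
  "glue_verts j = Glue j ` {1..6}"

definition glue_edges :: "nat \<Rightarrow> vertex rel" where
  "glue_edges j =
     {(Left j 1, Glue j 1), (Left j 1, Glue j 2), (Right j 2, Glue j 1), (Right j 2, Glue j 2),
      (Left (j + 1) 6, Glue j 1), (Right (j + 1) 6, Glue j 2),
      (Left j 3, Glue j 3), (Left j 3, Glue j 4), (Right j 4, Glue j 3), (Right j 4, Glue j 4),
      (Left (j + 1) 1, Glue j 3), (Right (j + 1) 1, Glue j 4),
      (Left j 5, Glue j 5), (Left j 5, Glue j 6), (Right j 6, Glue j 5), (Right j 6, Glue j 6),
      (Left (j + 1) 6, Glue j 5), (Right (j + 1) 6, Glue j 6)}"

definition ladder_graph :: "nat \<Rightarrow> vertex pair_pre_digraph" where
  "ladder_graph n =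
     \<lparr>pverts = (\<Union>j\<in>{1..n}. ladder_verts j) \<union> (\<Union>j\<in>{1..<n}. glue_verts j),
      parcs = symcl ((\<Union>j\<in>{1..n}. ladder_edges j) \<union> (\<Union>j\<in>{1..<n}. glue_edges j))\<rparr>"

definition state_S1 :: "nat \<Rightarrow> vertex set \<Rightarrow> bool" where
  "state_S1 j X \<longleftrightarrow>
     X \<inter> ladder_verts j = {Left j 1, Left j 3, Left j 5, Right j 1, Right j 3, Right j 5}"

definition state_S7 :: "nat \<Rightarrow> vertex set \<Rightarrow> bool" where
  "state_S7 j X \<longleftrightarrow>
     X \<inter> ladder_verts j = {Left j 2, Left j 4, Left j 6, Right j 2, Right j 4, Right j 6}"

lemma interval_5: "{1..5} = {1, 2, 3, 4, 5 :: nat}" and interval_6: "{1..6} = {1, 2, 3, 4, 5, 6 :: nat}"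
  and interval_3: "{1..3} = {1, 2, 3 :: nat}"
  by auto

lemma card_linked_pairs: "card (linked_pairs j) = 15"
  unfolding linked_pairs_def interval_5 by simp

lemma card_ladder_verts: "card (ladder_verts j) = 57"
  unfolding ladder_verts_def linked_pairs_def gadget_verts_def interval_3 interval_5 interval_6
  by simp

lemma ladder_edges_wf:
  "(x, y) \<in> ladder_edges j \<Longrightarrow> x \<in> ladder_verts j \<and> y \<in> ladder_verts j \<and> x \<noteq> y"
  unfolding ladder_edges_def ladder_verts_def gadget_edges_def linked_pairs_def gadget_verts_def
    interval_3 interval_5 interval_6
  by auto

lemma Left_in_ladder_verts: "i \<in> {1..6} \<Longrightarrow> Left j i \<in> ladder_verts j"
  and Right_in_ladder_verts: "i \<in> {1..6} \<Longrightarrow> Right j i \<in> ladder_verts j"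
  unfolding ladder_verts_def by auto

lemma glue_edges_wf:
  assumes "(x, y) \<in> glue_edges j"
  shows "x \<in> ladder_verts j \<union> ladder_verts (j + 1) \<and> y \<in> glue_verts j \<and> x \<noteq> y"
  using assms unfolding glue_edges_def glue_verts_def
  by (auto intro!: imageI intro: Left_in_ladder_verts Right_in_ladder_verts)

lemma finite_ladder_verts: "finite (ladder_verts j)"
  by (rule card_ge_0_finite) (simp add: card_ladder_verts)

lemma pair_graph_ladder_graph: "pair_graph (ladder_graph n)"
proof -
  let ?E = "(\<Union>j\<in>{1..n}. ladder_edges j) \<union> (\<Union>j\<in>{1..<n}. glue_edges j)"
  let ?V = "pverts (ladder_graph n)"
  have arcs: "parcs (ladder_graph n) = symcl ?E"
    by (simp add: ladder_graph_def)
  have E: "x \<in> ?V \<and> y \<in> ?V \<and> x \<noteq> y" if xy: "(x, y) \<in> ?E" for x y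
  proof (cases "\<exists>j\<in>{1..n}. (x, y) \<in> ladder_edges j")
    case True
    then show ?thesis by (auto simp: ladder_graph_def dest: ladder_edges_wf)
  next
    case False
    then obtain j where j: "j \<in> {1..<n}" "(x, y) \<in> glue_edges j" using xy by auto
    have "x \<in> (\<Union>i\<in>{j, j + 1}. ladder_verts i)" "y \<in> glue_verts j" "x \<noteq> y"
      using glue_edges_wf[OF j(2)] by auto
    moreover have "{j, j + 1} \<subseteq> {1..n}" using j(1) by auto
    ultimately show ?thesis using j(1) unfolding ladder_graph_def by fastforce
  qed
  have arcD: "fst e \<in> ?V \<and> snd e \<in> ?V \<and> fst e \<noteq> snd e" if "e \<in> parcs (ladder_graph n)" for e
  proof -
    obtain x y where e: "e = (x, y)" by (cases e)
    have "(x, y) \<in> ?E \<or> (y, x) \<in> ?E"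
      using that unfolding arcs e symcl_def by (elim UnE imageE) auto
    then show ?thesis using E[of x y] E[of y x] e by auto
  qed
  have finV: "finite ?V"
    by (simp add: ladder_graph_def finite_ladder_verts glue_verts_def)
  have "parcs (ladder_graph n) \<subseteq> ?V \<times> ?V"
    using arcD by (auto simp: mem_Times_iff)
  then have finE: "finite (parcs (ladder_graph n))"
    using finV by (meson finite_SigmaI finite_subset)
  have sym: "symmetric (ladder_graph n)"
    unfolding symmetric_def with_proj_simps arcs symcl_def sym_def by force
  show ?thesis
    by unfold_locales (use arcD finV finE sym in auto)
qed

end

theory Submission
  imports Defs
begin

text \<open>
  The fifteen gadgets of a ladder contain six disjoint ones, each of which needs a vertex of its own.
  Hence \<open>\<gamma>(G\<^sub>n) = 6n\<close>, and of the two ends of any reconfiguration step one has exactly \<open>6n\<close>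
  vertices. Such a minimum dominating set places each ladder in one of seven linearly ordered
  states, and the gluing vertices force ladder \<open>j + 1\<close> to its last, first, last state when
  ladder \<open>j\<close> is in its second, fourth, sixth state. So each traversal of ladder \<open>j\<close> drags ladder
  \<open>j + 1\<close> through about two traversals. To count these, unfold the back-and-forth motion of ladder
  \<open>j + 1\<close> into a position on the integer line that is a function of the unfolded position of ladder
  \<open>j\<close> and the current state of ladder \<open>j + 1\<close>. The sum of the unfolded positions changes by at most
  one in each step, and it is \<open>0\<close> at \<open>S\<close> and \<open>12 (2\<^sup>n\<^sup>+\<^sup>1 - n - 2)\<close> at \<open>T\<close>.
\<close>

text \<open>Used in two roles: as a dominating set that bounds the domination number, and as a set
  of names for the six disjoint gadgets of a ladder.\<close>

definition odd_verts :: "nat \<Rightarrow> vertex set" where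
  "odd_verts j = {Left j 1, Left j 3, Left j 5, Right j 1, Right j 3, Right j 5}"

text \<open>Identifies the gadget of a perfect matching of the linked pairs to which a vertex belongs
  by its odd end; the internal vertices of the other gadgets may be assigned arbitrarily.\<close>

fun owner :: "vertex \<Rightarrow> vertex" where
  "owner (Left j i) = Left j (if even i then i - 1 else i)"
| "owner (Right j i) = Right j (if even i then i - 1 else i)"
| "owner (Internal x y m) = owner x"
| "owner (Glue j i) = Glue j i"

text \<open>A ladder in state \<open>S\<^sub>i\<close> has position \<open>2(i - 1)\<close>; a seventh ladder vertex shifts this by one.\<close>

definition position :: "vertex set \<Rightarrow> nat \<Rightarrow> int" where
  "position A j =
     6 + (\<Sum>i\<in>{1..6}. (-1) ^ i * (of_bool (Left j i \<in> A) + of_bool (Right j i \<in> A)))"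

text \<open>When ladder \<open>j\<close> has unfolded position \<open>P\<close>, the unfolded position of ladder \<open>j + 1\<close> lies in the
  interval \<open>[12 c, 12 c + 12]\<close> with \<open>c = lift_index P\<close>, which reverses the direction of motion for
  odd \<open>c\<close>. The index goes up when \<open>P\<close> reaches \<open>2\<close> or \<open>6\<close> modulo \<open>12\<close>, where the gluing vertices hold
  ladder \<open>j + 1\<close> at the common endpoint of the two intervals. It does not change at \<open>10\<close> modulo \<open>12\<close>:
  ladder \<open>j\<close> turns around at \<open>12\<close>, and at \<open>14\<close> ladder \<open>j + 1\<close> has to be in its last state again.\<close>

definition lift_index :: "int \<Rightarrow> int" where
  "lift_index P = (2 * ((P + 2) div 4) + 2) div 3"

definition lift :: "int \<Rightarrow> int \<Rightarrow> int" where
  "lift P q = 12 * lift_index P + (if even (lift_index P) then q else 12 - q)"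

fun lifted :: "(nat \<Rightarrow> int) \<Rightarrow> nat \<Rightarrow> int" where
  "lifted q 0 = 0"
| "lifted q (Suc j) = lift (lifted q j) (q (Suc j))"

section \<open>Adjacency in the ladder graph\<close>

lemma linked_pairs_eq:
  "linked_pairs j =
     {(Left j 5, Left j 6), (Right j 5, Right j 6), (Left j 6, Right j 5),
      (Left j 4, Left j 5), (Right j 4, Right j 5), (Left j 5, Right j 4),
      (Left j 3, Left j 4), (Right j 3, Right j 4), (Left j 4, Right j 3),
      (Left j 2, Left j 3), (Right j 2, Right j 3), (Left j 3, Right j 2),
      (Left j 1, Left j 2), (Right j 1, Right j 2), (Left j 2, Right j 1)}"
  unfolding linked_pairs_def interval_5 by (simp del: One_nat_def)

lemma ladder_graph_dominates_iff:
  "v \<rightarrow>\<^bsub>with_proj (ladder_graph n)\<^esub> u \<longleftrightarrow>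
     (\<exists>j\<in>{1..n}. (v, u) \<in> ladder_edges j \<or> (u, v) \<in> ladder_edges j) \<or>
     (\<exists>j\<in>{1..<n}. (v, u) \<in> glue_edges j \<or> (u, v) \<in> glue_edges j)"
  by (auto simp: ladder_graph_def symcl_def image_iff split: prod.splits)

lemma linked_pairs_ladder_vertex:
  "(Internal x y m, u) \<notin> linked_pairs j" "(u, Internal x y m) \<notin> linked_pairs j"
  "(Glue i l, u) \<notin> linked_pairs j" "(u, Glue i l) \<notin> linked_pairs j"
  by (auto simp: linked_pairs_def)

lemma ladder_edges_iff:
  "(u, v) \<in> ladder_edges j \<longleftrightarrow> (u, v) \<in> linked_pairs j \<or>
     (\<exists>(x, y) \<in> linked_pairs j. v \<in> gadget_verts x y \<and> (u = x \<or> u = y))"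
  by (fastforce simp: ladder_edges_def gadget_edges_def)

lemma Internal_neighbour:
  assumes "Internal x y m \<rightarrow>\<^bsub>with_proj (ladder_graph n)\<^esub> u"
  shows "u = x \<or> u = y"
proof -
  have "(Internal x y m, u) \<notin> glue_edges j \<and> (u, Internal x y m) \<notin> glue_edges j" for j
    by (simp add: glue_edges_def)
  then show ?thesis
    using assms unfolding ladder_graph_dominates_iff ladder_edges_iff
    by (auto simp: linked_pairs_ladder_vertex gadget_verts_def)
qed

lemma Glue_neighbour:
  assumes "Glue j i \<rightarrow>\<^bsub>with_proj (ladder_graph n)\<^esub> u"
  shows "(u, Glue j i) \<in> glue_edges j"
proof -
  have "(Glue j i, u) \<notin> glue_edges j'" for j'
    by (simp add: glue_edges_def)
  moreover have "(u, Glue j i) \<in> glue_edges j' \<Longrightarrow> j' = j" for j'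
    by (auto simp: glue_edges_def)
  ultimately show ?thesis
    using assms unfolding ladder_graph_dominates_iff ladder_edges_iff
    by (auto simp: linked_pairs_ladder_vertex gadget_verts_def)
qed

section \<open>Upper bound on the domination number\<close>

lemma card_odd_verts: "card (\<Union>j\<in>{1..n}. odd_verts j) = 6 * n"
proof -
  have "card (\<Union>j\<in>{1..n}. odd_verts j) = (\<Sum>j\<in>{1..n}. card (odd_verts j))"
    by (rule card_UN_disjoint) (auto simp: odd_verts_def)
  then show ?thesis
    by (simp add: odd_verts_def)
qed

lemma odd_verts_subset: "odd_verts j \<subseteq> ladder_verts j"
  unfolding odd_verts_def by (simp add: Left_in_ladder_verts Right_in_ladder_verts)

text \<open>The indices of two linked vertices are consecutive, so one of them is odd.\<close>

lemma odd_verts_cover: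
  assumes "(x, y) \<in> linked_pairs j"
  shows "x \<in> odd_verts j \<or> y \<in> odd_verts j"
  using assms unfolding linked_pairs_eq by (elim insertE) (simp_all add: odd_verts_def)

lemma odd_verts_dominate_ladder:
  assumes "v \<in> ladder_verts j" "v \<notin> odd_verts j"
  shows "\<exists>u\<in>odd_verts j. (v, u) \<in> ladder_edges j \<or> (u, v) \<in> ladder_edges j"
proof -
  consider i where "i \<in> {1..6}" "v = Left j i" | i where "i \<in> {1..6}" "v = Right j i"
    | x y where "(x, y) \<in> linked_pairs j" "v \<in> gadget_verts x y"
    using assms(1) unfolding ladder_verts_def by blast
  then show ?thesis
  proof cases
    case 1
    then have "i \<in> {2, 4, 6}"
      using assms(2) unfolding interval_6 by (auto simp: odd_verts_def)
    then have "(Left j (i - 1), v) \<in> linked_pairs j" "Left j (i - 1) \<in> odd_verts j"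
      unfolding 1 linked_pairs_def odd_verts_def by auto
    then show ?thesis
      unfolding ladder_edges_iff by blast
  next
    case 2
    then have "i \<in> {2, 4, 6}"
      using assms(2) unfolding interval_6 by (auto simp: odd_verts_def)
    then have "(Right j (i - 1), v) \<in> linked_pairs j" "Right j (i - 1) \<in> odd_verts j"
      unfolding 2 linked_pairs_def odd_verts_def by auto
    then show ?thesis
      unfolding ladder_edges_iff by blast
  next
    case 3
    then show ?thesis
      using odd_verts_cover unfolding ladder_edges_iff by blast
  qed
qed

lemma dominating_odd_verts:
  "dominating_set (with_proj (ladder_graph n)) (\<Union>j\<in>{1..n}. odd_verts j)" (is "dominating_set ?G ?U")
proof -
  have "?U \<subseteq> verts ?G"
    using odd_verts_subset by (auto simp: ladder_graph_def)
  moreover have "\<exists>u\<in>?U. v \<rightarrow>\<^bsub>?G\<^esub> u" if "v \<in> verts ?G" "v \<notin> ?U" for v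
  proof -
    consider j where "j \<in> {1..n}" "v \<in> ladder_verts j" | j where "j \<in> {1..<n}" "v \<in> glue_verts j"
      using \<open>v \<in> verts ?G\<close> by (auto simp: ladder_graph_def)
    then show ?thesis
    proof cases
      case 1
      then have "v \<notin> odd_verts j"
        using \<open>v \<notin> ?U\<close> by auto
      then have "\<exists>u\<in>odd_verts j. (v, u) \<in> ladder_edges j \<or> (u, v) \<in> ladder_edges j"
        using 1(2) odd_verts_dominate_ladder by blast
      then show ?thesis
        using 1(1) unfolding ladder_graph_dominates_iff by blast
    next
      case 2
      \<comment> \<open>\<open>Left j 1\<close>, \<open>Left j 3\<close> and \<open>Left j 5\<close>
        dominate two vertices of \<open>glue_verts j\<close> each, and thus all six.\<close>
      then have "\<exists>u\<in>odd_verts j. (u, v) \<in> glue_edges j"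
        unfolding glue_verts_def interval_6 by (auto simp: glue_edges_def odd_verts_def)
      then show ?thesis
        using 2(1) unfolding ladder_graph_dominates_iff by fastforce
    qed
  qed
  ultimately show ?thesis
    unfolding dominating_set_def by blast
qed

lemma finite_verts_ladder_graph: "finite (verts (with_proj (ladder_graph n)))"
  using finite_ladder_verts by (simp add: ladder_graph_def glue_verts_def)

lemma finite_dominating_set:
  assumes "dominating_set (with_proj (ladder_graph n)) A"
  shows "finite A"
  using assms finite_verts_ladder_graph[of n] finite_subset unfolding dominating_set_def by blast

lemma domination_number_ladder_graph_le: "domination_number (with_proj (ladder_graph n)) \<le> 6 * n"
proof -
  let ?G = "with_proj (ladder_graph n)"
  have "finite {S. dominating_set ?G S}"
    using finite_verts_ladder_graph[of n]
    by (auto simp: dominating_set_def intro: finite_subset[of _ "Pow (verts ?G)"])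
  then show ?thesis
    unfolding domination_number_def card_odd_verts[of n, symmetric]
    using dominating_odd_verts by (intro Min_le) auto
qed

section \<open>Structure of the dominating sets with at most 6n vertices\<close>

lemma dominates_gadget:
  assumes "dominating_set (with_proj (ladder_graph n)) A" "j \<in> {1..n}" "(x, y) \<in> linked_pairs j"
    and "x \<notin> A" "y \<notin> A"
  shows "gadget_verts x y \<subseteq> A"
proof
  fix z assume z: "z \<in> gadget_verts x y"
  then have "z \<in> ladder_verts j"
    using assms(3) unfolding ladder_verts_def by blast
  then have "z \<in> verts (with_proj (ladder_graph n))"
    using assms(2) by (auto simp: ladder_graph_def)
  \<comment> \<open>Only \<open>x\<close> and \<open>y\<close> can be neighbours of
    \<open>z\<close>, so \<open>z\<close> has to be chosen itself.\<close>
  then show "z \<in> A"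
    using assms z Internal_neighbour unfolding dominating_set_def gadget_verts_def by fast
qed

text \<open>Each matching gadget must contain a vertex of \<open>A\<close>, so \<open>owner\<close>
  hits all \<open>6 * n\<close> odd vertices; the size bound leaves no room for collisions or
  further values.\<close>

lemma small_dominating_set_owner:
  assumes dom: "dominating_set (with_proj (ladder_graph n)) A" and card: "card A \<le> 6 * n"
  shows "bij_betw owner A (\<Union>j\<in>{1..n}. odd_verts j)" (is "bij_betw _ _ ?U")
proof -
  have fin: "finite A"
    using dom by (rule finite_dominating_set)
  have block: "x \<in> owner ` A"
    if "(x, y) \<in> linked_pairs j" "owner x = x" "owner y = x" "j \<in> {1..n}" for x y j
  proof (cases "x \<in> A \<or> y \<in> A")
    case True
    then show ?thesis
      using that by (metis image_eqI)
  next
    case False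
    then have "Internal x y 1 \<in> A"
      using dominates_gadget[OF dom that(4,1)] by (auto simp: gadget_verts_def)
    then show ?thesis
      using that by (metis image_eqI owner.simps(3))
  qed
  have "?U \<subseteq> owner ` A"
  proof
    fix v assume "v \<in> ?U"
    then obtain j i where j: "j \<in> {1..n}" and "i \<in> {1, 3, 5}" and v: "v = Left j i \<or> v = Right j i"
      by (auto simp: odd_verts_def)
    then show "v \<in> owner ` A"
      using block[OF _ _ _ j, of "Left j i" "Left j (i + 1)"]
        block[OF _ _ _ j, of "Right j i" "Right j (i + 1)"]
      by (auto simp: linked_pairs_eq)
  qed
  moreover have "card (owner ` A) \<le> card ?U"
    using card_image_le[OF fin, of owner] card unfolding card_odd_verts by linarith
  ultimately have eq: "?U = owner ` A"
    using fin by (simp add: card_seteq)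
  then have "card (owner ` A) = card A"
    using card card_image_le[OF fin, of owner] card_odd_verts[of n] by simp
  then show ?thesis
    using eq fin unfolding bij_betw_def by (simp add: eq_card_imp_inj_on)
qed


text \<open>Otherwise all internal vertices of the gadget lie in \<open>A\<close>. They share their
  owner, whether or not the gadget belongs to the matching, so two of them already contradict
  injectivity.\<close>

lemma small_dominating_set_covers:
  assumes dom: "dominating_set (with_proj (ladder_graph n)) A" and card: "card A \<le> 6 * n"
    and "j \<in> {1..n}" "(x, y) \<in> linked_pairs j"
  shows "x \<in> A \<or> y \<in> A"
proof (rule ccontr)
  assume "\<not> (x \<in> A \<or> y \<in> A)"
  then have "Internal x y 1 \<in> A" "Internal x y 2 \<in> A"
    using dominates_gadget[OF dom assms(3,4)] by (auto simp: gadget_verts_def)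
  moreover have "inj_on owner A"
    using small_dominating_set_owner[OF dom card] by (rule bij_betw_imp_inj_on)
  ultimately have "Internal x y 1 = Internal x y 2"
    by (metis inj_onD owner.simps(3))
  then show False
    by simp
qed

text \<open>\<open>owner\<close> fixes gluing vertices, so such a vertex would be a value outside
  the odd vertices.\<close>

lemma small_dominating_set_no_glue:
  assumes "dominating_set (with_proj (ladder_graph n)) A" "card A \<le> 6 * n"
  shows "Glue j i \<notin> A"
proof
  assume "Glue j i \<in> A"
  then have "owner (Glue j i) \<in> (\<Union>j\<in>{1..n}. odd_verts j)"
    using small_dominating_set_owner[OF assms] bij_betwE by blast
  then show False
    by (auto simp: odd_verts_def)
qed

lemma position_unfold:
  "position A j = 6
     + of_bool (Left j 2 \<in> A) + of_bool (Left j 4 \<in> A) + of_bool (Left j 6 \<in> A)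
     + of_bool (Right j 2 \<in> A) + of_bool (Right j 4 \<in> A) + of_bool (Right j 6 \<in> A)
     - of_bool (Left j 1 \<in> A) - of_bool (Left j 3 \<in> A) - of_bool (Left j 5 \<in> A)
     - of_bool (Right j 1 \<in> A) - of_bool (Right j 3 \<in> A) - of_bool (Right j 5 \<in> A)"
  unfolding position_def interval_6 by simp

lemma small_dominating_set_position:
  assumes dom: "dominating_set (with_proj (ladder_graph n)) A" and card: "card A \<le> 6 * n"
    and j: "j \<in> {1..n}"
  shows "position A j \<in> {0, 2, 4, 6, 8, 10, 12}"
    and "position A j = 2 \<Longrightarrow> Left j 1 \<notin> A \<and> Right j 2 \<notin> A"
    and "position A j = 6 \<Longrightarrow> Left j 3 \<notin> A \<and> Right j 4 \<notin> A"
    and "position A j = 10 \<Longrightarrow> Left j 5 \<notin> A \<and> Right j 6 \<notin> A"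
    and "Left j 1 \<in> A \<Longrightarrow> Right j 1 \<in> A \<Longrightarrow> position A j = 0"
    and "Left j 6 \<in> A \<Longrightarrow> Right j 6 \<in> A \<Longrightarrow> position A j = 12"
proof -
  have inj: "inj_on owner A"
    using small_dominating_set_owner[OF dom card] by (rule bij_betw_imp_inj_on)
  note cover = small_dominating_set_covers[OF dom card j]
  have match: "y \<in> A \<longleftrightarrow> x \<notin> A"
    if "(x, y) \<in> linked_pairs j" "owner x = owner y" "x \<noteq> y" for x y
    using cover[OF that(1)] inj_onD[OF inj that(2)] that(3) by blast
  have matches:
    "Left j 2 \<in> A \<longleftrightarrow> Left j 1 \<notin> A" "Left j 4 \<in> A \<longleftrightarrow> Left j 3 \<notin> A"
    "Left j 6 \<in> A \<longleftrightarrow> Left j 5 \<notin> A" "Right j 2 \<in> A \<longleftrightarrow> Right j 1 \<notin> A"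
    "Right j 4 \<in> A \<longleftrightarrow> Right j 3 \<notin> A" "Right j 6 \<in> A \<longleftrightarrow> Right j 5 \<notin> A"
    by (rule match; simp add: linked_pairs_eq)+
  have "Left j 2 \<in> A \<or> Right j 1 \<in> A" "Left j 3 \<in> A \<or> Right j 2 \<in> A"
    "Left j 4 \<in> A \<or> Right j 3 \<in> A" "Left j 5 \<in> A \<or> Right j 4 \<in> A"
    "Left j 6 \<in> A \<or> Right j 5 \<in> A"
    by (rule cover; simp add: linked_pairs_eq)+
  \<comment> \<open>In the order \<open>Left j 1\<close>, \<open>Right j 1\<close>,
    \<open>Left j 3\<close>, \<open>Right j 3\<close>, \<open>Left j 5\<close>,
    \<open>Right j 5\<close>, membership in \<open>A\<close> passes on to every later vertex. The
    seven states correspond to the first member, if any.\<close>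
  then have chain:
    "Left j 1 \<in> A \<Longrightarrow> Right j 1 \<in> A" "Right j 1 \<in> A \<Longrightarrow> Left j 3 \<in> A"
    "Left j 3 \<in> A \<Longrightarrow> Right j 3 \<in> A" "Right j 3 \<in> A \<Longrightarrow> Left j 5 \<in> A"
    "Left j 5 \<in> A \<Longrightarrow> Right j 5 \<in> A"
    using matches by blast+
  consider "Left j 1 \<in> A" | "Left j 1 \<notin> A" "Right j 1 \<in> A" | "Right j 1 \<notin> A" "Left j 3 \<in> A"
    | "Left j 3 \<notin> A" "Right j 3 \<in> A" | "Right j 3 \<notin> A" "Left j 5 \<in> A"
    | "Left j 5 \<notin> A" "Right j 5 \<in> A" | "Right j 5 \<notin> A"
    by blast
  then have "position A j \<in> {0, 2, 4, 6, 8, 10, 12} \<and>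
    (position A j = 2 \<longrightarrow> Left j 1 \<notin> A \<and> Right j 2 \<notin> A) \<and>
    (position A j = 6 \<longrightarrow> Left j 3 \<notin> A \<and> Right j 4 \<notin> A) \<and>
    (position A j = 10 \<longrightarrow> Left j 5 \<notin> A \<and> Right j 6 \<notin> A) \<and>
    (Left j 1 \<in> A \<longrightarrow> Right j 1 \<in> A \<longrightarrow> position A j = 0) \<and>
    (Left j 6 \<in> A \<longrightarrow> Right j 6 \<in> A \<longrightarrow> position A j = 12)"
    unfolding position_unfold matches using chain by cases auto
  then show "position A j \<in> {0, 2, 4, 6, 8, 10, 12}"
    and "position A j = 2 \<Longrightarrow> Left j 1 \<notin> A \<and> Right j 2 \<notin> A"
    and "position A j = 6 \<Longrightarrow> Left j 3 \<notin> A \<and> Right j 4 \<notin> A"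
    and "position A j = 10 \<Longrightarrow> Left j 5 \<notin> A \<and> Right j 6 \<notin> A"
    and "Left j 1 \<in> A \<Longrightarrow> Right j 1 \<in> A \<Longrightarrow> position A j = 0"
    and "Left j 6 \<in> A \<Longrightarrow> Right j 6 \<in> A \<Longrightarrow> position A j = 12"
    by blast+
qed

text \<open>A ladder in its second, fourth or sixth state leaves two gluing vertices without a
  neighbour in it. Their remaining neighbours are distinct and must both be chosen, which only one
  state of ladder \<open>j + 1\<close> allows.\<close>

lemma small_dominating_set_next_position:
  assumes dom: "dominating_set (with_proj (ladder_graph n)) A" and card: "card A \<le> 6 * n"
    and j: "j \<in> {1..<n}"
  shows "position A j \<in> {2, 10} \<Longrightarrow> position A (j + 1) = 12"
    and "position A j = 6 \<Longrightarrow> position A (j + 1) = 0"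
proof -
  have j': "j \<in> {1..n}" "j + 1 \<in> {1..n}"
    using j by auto
  note position = small_dominating_set_position[OF dom card]
  have glue: "\<exists>u\<in>A. (u, Glue j i) \<in> glue_edges j" if "i \<in> {1..6}" for i
  proof -
    have "Glue j i \<in> glue_verts j"
      using that by (simp add: glue_verts_def)
    then have "Glue j i \<in> verts (with_proj (ladder_graph n)) - A"
      using j small_dominating_set_no_glue[OF dom card] by (auto simp: ladder_graph_def)
    then show ?thesis
      using dom Glue_neighbour unfolding dominating_set_def by blast
  qed
  have "\<exists>u\<in>A. (u, Glue j 1) \<in> glue_edges j" "\<exists>u\<in>A. (u, Glue j 2) \<in> glue_edges j"
    "\<exists>u\<in>A. (u, Glue j 3) \<in> glue_edges j" "\<exists>u\<in>A. (u, Glue j 4) \<in> glue_edges j"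
    "\<exists>u\<in>A. (u, Glue j 5) \<in> glue_edges j" "\<exists>u\<in>A. (u, Glue j 6) \<in> glue_edges j"
    by (rule glue; simp)+
  then have dominated:
    "Left j 1 \<in> A \<or> Right j 2 \<in> A \<or> Left (j + 1) 6 \<in> A \<and> Right (j + 1) 6 \<in> A"
    "Left j 3 \<in> A \<or> Right j 4 \<in> A \<or> Left (j + 1) 1 \<in> A \<and> Right (j + 1) 1 \<in> A"
    "Left j 5 \<in> A \<or> Right j 6 \<in> A \<or> Left (j + 1) 6 \<in> A \<and> Right (j + 1) 6 \<in> A"
    unfolding glue_edges_def by auto
  show "position A (j + 1) = 12" if "position A j \<in> {2, 10}"
    using that position(2,4)[OF j'(1)] dominated(1,3) position(6)[OF j'(2)] by blast
  show "position A (j + 1) = 0" if "position A j = 6"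
    using position(3)[OF j'(1) that] dominated(2) position(5)[OF j'(2)] by blast
qed

section \<open>Arithmetic of the unfolded positions\<close>

lemma lift_index_add: "lift_index (12 * t + s) = 2 * t + lift_index s"
proof -
  have "(12 * t + s + 2) div 4 = 3 * t + (s + 2) div 4"
    using div_mult_self4[of 4 "3 * t" "s + 2"] by (simp add: add.assoc)
  moreover have "(2 * (3 * t + (s + 2) div 4) + 2) div 3 = 2 * t + (2 * ((s + 2) div 4) + 2) div 3"
    using div_mult_self4[of 3 "2 * t" "2 * ((s + 2) div 4) + 2"] by (simp add: algebra_simps)
  ultimately show ?thesis
    unfolding lift_index_def by simp
qed

text \<open>The index jumps only on reaching 2 or 6 modulo 12, and there \<open>q\<close> is forced
  to the endpoint shared by the two intervals, where both formulas agree.\<close>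

lemma lift_stable:
  assumes "even P" "\<bar>P' - P\<bar> \<le> 1" "P mod 12 \<in> {2, 10} \<Longrightarrow> q = 12" "P mod 12 = 6 \<Longrightarrow> q = 0"
  shows "lift P' q = lift P q"
proof -
  define t r where "t = P div 12" and "r = P mod 12"
  have P: "P = 12 * t + r"
    unfolding t_def r_def by simp
  have "even r" "0 \<le> r" "r < 12"
    using assms(1) unfolding r_def by (simp_all add: dvd_mod_iff)
  then have "r \<in> {0, 2, 4, 6, 8, 10}"
    by (simp; presburger)
  moreover have "P' = 12 * t + r \<or> P' = 12 * t + (r + 1) \<or> P' = 12 * t + (r - 1)"
    using assms(2) P by linarith
  moreover have "r = 2 \<Longrightarrow> q = 12" "r = 10 \<Longrightarrow> q = 12" "r = 6 \<Longrightarrow> q = 0"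
    using assms(3,4) unfolding r_def by auto
  \<comment> \<open>Periodicity leaves six residues with three neighbouring values each;
    \<open>lift_index\<close> is then evaluated on numerals.\<close>
  ultimately show ?thesis
    unfolding lift_def P by (elim disjE insertE) (simp_all only: lift_index_add, simp_all add: lift_index_def)
qed

lemma lift_mod: "lift P q mod 12 = q mod 12 \<or> lift P q mod 12 = - q mod 12"
  unfolding lift_def by (simp add: mod_simps flip: mod_mult_self2)

lemma even_lift_iff: "even (lift P q) \<longleftrightarrow> even q"
  unfolding lift_def by simp

lemma abs_lift_diff: "\<bar>lift P q - lift P q'\<bar> = \<bar>q - q'\<bar>"
  unfolding lift_def by auto

lemma even_lifted:
  assumes "\<And>j. j \<in> {1..m} \<Longrightarrow> even (q j)"
  shows "even (lifted q m)"
  using assms by (cases m) (auto simp: even_lift_iff)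

text \<open>Reflections lose the sign of the residue. This does no harm to
  \<open>lift_stable\<close>, as negation modulo 12 exchanges 2 and 10 and fixes 6.\<close>

lemma lifted_mod:
  assumes "j \<noteq> 0"
  shows "lifted q j mod 12 = q j mod 12 \<or> lifted q j mod 12 = - q j mod 12"
  using assms lift_mod by (cases j) auto

lemma lifted_const_0:
  assumes "\<And>j. j \<in> {1..m} \<Longrightarrow> q j = 0"
  shows "lifted q m = 0"
  using assms by (induction m) (auto simp: lift_def lift_index_def)

text \<open>An unfolded position \<open>12 * a\<close> has the even index \<open>2 * a\<close>, so
  the next ladder is at \<open>24 * a + 12\<close>: the number of traversals goes from
  \<open>a\<close> to \<open>2 * a + 1\<close>.\<close>

lemma lifted_const_12:
  assumes "\<And>j. j \<in> {1..m} \<Longrightarrow> q j = 12"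
  shows "lifted q m = 12 * (2 ^ m - 1)"
  using assms
proof (induction m)
  case (Suc m)
  define a :: int where "a = 2 ^ m - 1"
  have "lift_index (12 * a) = 2 * a"
    using lift_index_add[of a 0] by (simp add: lift_index_def)
  moreover have "lifted q m = 12 * a"
    using Suc unfolding a_def by simp
  moreover have "q (Suc m) = 12"
    using Suc.prems by simp
  ultimately have "lifted q (Suc m) = 24 * a + 12"
    by (simp add: lift_def)
  then show ?case
    by (simp add: a_def)
qed simp

text \<open>Earlier ladders do not see the change, \<open>lift\<close> preserves distances in its
  second argument, and \<open>lift_stable\<close> absorbs the change at the successor of
  \<open>j0\<close>, so nothing propagates. The constraints concern \<open>q\<close> alone because
  \<open>q'\<close> may come from a set with one vertex more.\<close>

lemma lifted_change_one:
  assumes j0: "j0 \<in> {1..n}"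
    and same: "\<And>j. j \<noteq> j0 \<Longrightarrow> q' j = q j"
    and step: "\<bar>q' j0 - q j0\<bar> \<le> 1"
    and range: "\<And>j. j \<in> {1..n} \<Longrightarrow> q j \<in> {0, 2, 4, 6, 8, 10, 12}"
    and next12: "\<And>j. j \<in> {1..<n} \<Longrightarrow> q j \<in> {2, 10} \<Longrightarrow> q (j + 1) = 12"
    and next0: "\<And>j. j \<in> {1..<n} \<Longrightarrow> q j = 6 \<Longrightarrow> q (j + 1) = 0"
    and "m \<le> n"
  shows "if m = j0 then \<bar>lifted q' m - lifted q m\<bar> \<le> 1 else lifted q' m = lifted q m"
  using \<open>m \<le> n\<close>
proof (induction m)
  case 0
  then show ?case
    using j0 by simp
next
  case (Suc m)
  consider "m = j0" | "Suc m = j0" | "m \<noteq> j0" "Suc m \<noteq> j0"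
    by blast
  then show ?case
  proof cases
    case 1
    then have m: "m \<in> {1..<n}" "m \<in> {1..n}" "m \<noteq> 0"
      using j0 Suc.prems by auto
    have "even (lifted q m)"
      by (rule even_lifted) (use range Suc.prems in fastforce)
    moreover have "\<bar>lifted q' m - lifted q m\<bar> \<le> 1"
      using Suc 1 by simp
    moreover have "q (Suc m) = 12" if "lifted q m mod 12 \<in> {2, 10}"
      using that lifted_mod[OF m(3), of q] range[OF m(2)] next12[OF m(1)] by auto
    moreover have "q (Suc m) = 0" if "lifted q m mod 12 = 6"
      using that lifted_mod[OF m(3), of q] range[OF m(2)] next0[OF m(1)] by auto
    ultimately have "lift (lifted q' m) (q (Suc m)) = lift (lifted q m) (q (Suc m))"
      by (rule lift_stable)
    then show ?thesis
      using 1 same by simp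
  next
    case 2
    then have "lifted q' m = lifted q m"
      using Suc by auto
    then show ?thesis
      using step by (simp add: abs_lift_diff flip: 2)
  next
    case 3
    then show ?thesis
      using Suc same by simp
  qed
qed

section \<open>The potential and its values at the two ends\<close>

definition potential :: "nat \<Rightarrow> vertex set \<Rightarrow> int" where
  "potential n A = (\<Sum>j\<in>{1..n}. lifted (position A) j)"

lemma potential_S1:
  assumes "\<forall>j\<in>{1..n}. state_S1 j A"
  shows "potential n A = 0"
proof -
  have "position A j = 0" if "j \<in> {1..n}" for j
  proof -
    have "v \<in> A \<longleftrightarrow> v \<in> {Left j 1, Left j 3, Left j 5, Right j 1, Right j 3, Right j 5}"
      if "v \<in> ladder_verts j" for v
      using assms \<open>j \<in> {1..n}\<close> that unfolding state_S1_def by blast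
    then show ?thesis
      by (simp add: position_unfold Left_in_ladder_verts Right_in_ladder_verts)
  qed
  then show ?thesis
    unfolding potential_def by (intro sum.neutral ballI lifted_const_0) auto
qed

lemma potential_S7:
  assumes "\<forall>j\<in>{1..n}. state_S7 j A"
  shows "potential n A = 12 * (2 ^ (n + 1) - int n - 2)"
proof -
  have "position A j = 12" if "j \<in> {1..n}" for j
  proof -
    have "v \<in> A \<longleftrightarrow> v \<in> {Left j 2, Left j 4, Left j 6, Right j 2, Right j 4, Right j 6}"
      if "v \<in> ladder_verts j" for v
      using assms \<open>j \<in> {1..n}\<close> that unfolding state_S7_def by blast
    then show ?thesis
      by (simp add: position_unfold Left_in_ladder_verts Right_in_ladder_verts)
  qed
  then have "lifted (position A) j = 12 * (2 ^ j - 1)" if "j \<in> {1..n}" for j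
    using that by (intro lifted_const_12) auto
  then have "potential n A = (\<Sum>j\<in>{1..n}. 12 * (2 ^ j - 1))"
    unfolding potential_def by simp
  also have "\<dots> = 12 * (2 ^ (n + 1) - int n - 2)"
    by (induction n) (auto simp: algebra_simps)
  finally show ?thesis .
qed

section \<open>Change of the potential in one reconfiguration step\<close>

lemma position_insert_Left:
  assumes "Left a b \<notin> A"
  shows "position (insert (Left a b) A) j =
    position A j + (if j = a \<and> b \<in> {1..6} then (-1) ^ b else 0)"
proof -
  let ?f = "\<lambda>A i. (-1) ^ i * (of_bool (Left j i \<in> A) + of_bool (Right j i \<in> A)) :: int"
  have "(\<Sum>i\<in>{1..6}. ?f (insert (Left a b) A) i) =
      (\<Sum>i\<in>{1..6}. ?f A i + (if b = i then if j = a then (-1) ^ b else 0 else 0))"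
    using assms by (intro sum.cong) auto
  then show ?thesis
    unfolding position_def sum.distrib by (simp add: sum.delta)
qed

lemma position_insert_Right:
  assumes "Right a b \<notin> A"
  shows "position (insert (Right a b) A) j =
    position A j + (if j = a \<and> b \<in> {1..6} then (-1) ^ b else 0)"
proof -
  let ?f = "\<lambda>A i. (-1) ^ i * (of_bool (Left j i \<in> A) + of_bool (Right j i \<in> A)) :: int"
  have "(\<Sum>i\<in>{1..6}. ?f (insert (Right a b) A) i) =
      (\<Sum>i\<in>{1..6}. ?f A i + (if b = i then if j = a then (-1) ^ b else 0 else 0))"
    using assms by (intro sum.cong) auto
  then show ?thesis
    unfolding position_def sum.distrib by (simp add: sum.delta)
qed

lemma position_insert_other:
  "position (insert (Internal x y m) A) j = position A j"
  "position (insert (Glue a b) A) j = position A j"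
  unfolding position_def by simp_all

lemmas position_insert = position_insert_Left position_insert_Right position_insert_other

lemma potential_insert:
  assumes dom: "dominating_set (with_proj (ladder_graph n)) A" and card: "card A \<le> 6 * n"
    and "v \<notin> A"
  shows "\<bar>potential n (insert v A) - potential n A\<bar> \<le> 1"
proof -
  let ?q = "position A" and ?q' = "position (insert v A)"
  obtain j0 where same: "\<And>j. j \<noteq> j0 \<Longrightarrow> ?q' j = ?q j" and step: "\<bar>?q' j0 - ?q j0\<bar> \<le> 1"
  proof
    \<comment> \<open>Internal and gluing vertices move no ladder; their default \<open>0\<close> is
      not the number of a ladder.\<close>
    define j0 where "j0 = (case v of Left j i \<Rightarrow> j | Right j i \<Rightarrow> j | _ \<Rightarrow> 0)"
    show "?q' j = ?q j" if "j \<noteq> j0" for j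
      using that \<open>v \<notin> A\<close> unfolding j0_def
      by (cases v) (simp_all add: position_insert)
    show "\<bar>?q' j0 - ?q j0\<bar> \<le> 1"
      using \<open>v \<notin> A\<close>
      by (cases v) (simp_all add: position_insert power_abs)
  qed
  show ?thesis
  proof (cases "j0 \<in> {1..n}")
    case True
    have change: "if m = j0 then \<bar>lifted ?q' m - lifted ?q m\<bar> \<le> 1 else lifted ?q' m = lifted ?q m"
      if "m \<le> n" for m
      using True same step small_dominating_set_position(1)[OF dom card]
        small_dominating_set_next_position[OF dom card] that
      by (rule lifted_change_one)
    have "potential n (insert v A) - potential n A = (\<Sum>j\<in>{1..n}. lifted ?q' j - lifted ?q j)"
      unfolding potential_def by (rule sum_subtractf[symmetric])
    also have "\<dots> = (\<Sum>j\<in>{j0}. lifted ?q' j - lifted ?q j)"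
      by (rule sum.mono_neutral_right) (use True change in auto)
    finally show ?thesis
      using change[of j0] True by simp
  next
    \<comment> \<open>Besides the default, this covers a \<open>v\<close> that names a ladder
      outside the graph.\<close>
    case False
    have "lifted ?q' m = lifted ?q m" if "m \<le> n" for m
      using that
    proof (induction m)
      case (Suc m)
      then have "Suc m \<noteq> j0"
        using False by auto
      then show ?case
        using Suc same by simp
    qed simp
    then show ?thesis
      unfolding potential_def by simp
  qed
qed

text \<open>The two sets differ by one vertex, so the smaller has at most \<open>6 * n\<close>
  vertices and \<open>potential_insert\<close> applies to it; the absolute value makes the direction
  of the step irrelevant.\<close>

lemma potential_reconf_step:
  assumes "k \<le> 6 * n + 1" and "(A, B) \<in> parcs (reconf_graph k (with_proj (ladder_graph n)))"
  shows "\<bar>potential n B - potential n A\<bar> \<le> 1"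
proof -
  let ?G = "with_proj (ladder_graph n)"
  have D: "dominating_set ?G A" "dominating_set ?G B" "card A \<le> 6 * n + 1" "card B \<le> 6 * n + 1"
    and "card (sym_diff A B) = 1"
    using assms by (auto simp: reconf_graph_def Let_def)
  have fin: "finite A" "finite B"
    using D(1,2) by (blast intro: finite_dominating_set)+
  obtain v where "sym_diff A B = {v}"
    using \<open>card (sym_diff A B) = 1\<close> card_1_singletonE by blast
  then have diff: "(x \<in> A) \<noteq> (x \<in> B) \<longleftrightarrow> x = v" for x
    by (auto simp: set_eq_iff)
  consider "B = insert v A" "v \<notin> A" | "A = insert v B" "v \<notin> B"
  proof (cases "v \<in> A")
    case True
    then show ?thesis
      using that(2) diff by (metis insertCI insertE subsetI subset_antisym)
  next
    case False
    then show ?thesis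
      using that(1) diff by (metis insertCI insertE subsetI subset_antisym)
  qed
  then show ?thesis
  proof cases
    case 1
    then show ?thesis
      using potential_insert[OF D(1) _ 1(2)] D(4) fin by simp
  next
    case 2
    then show ?thesis
      using potential_insert[OF D(2) _ 2(2)] D(3) fin by (simp add: abs_minus_commute)
  qed
qed

section \<open>From the potential to the length of a walk\<close>

lemma vwalk_length_ge_potential_diff:
  fixes f :: "'a \<Rightarrow> int"
  assumes "vwalk p G" and "\<And>u v. (u, v) \<in> arcs_ends G \<Longrightarrow> \<bar>f v - f u\<bar> \<le> 1"
  shows "f (last p) - f (hd p) \<le> int (vwalk_length p)"
  using assms(1)
proof (induction p rule: vwalk_induct)
  case (Cons u v es)
  then show ?case
    using assms(2)[of u v] by simp
qed simp

theorem theorem4: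
  fixes n :: nat and S T :: "vertex set" and p :: "vertex set vwalk"
  defines "k \<equiv> domination_number (ladder_graph n) + 1"
  assumes "n \<ge> 1"
    and "dominating_set (ladder_graph n) S" and "card S \<le> k"
    and "\<forall>j\<in>{1..n}. state_S1 j S"
    and "dominating_set (ladder_graph n) T" and "card T \<le> k"
    and "\<forall>j\<in>{1..n}. state_S7 j T"
    and "reconf_sequence k (ladder_graph n) S p T"
  shows "int (vwalk_length p) \<ge> 12 * (2 ^ (n + 1) - int n - 2)"
proof -
  have "k \<le> 6 * n + 1"
    unfolding k_def using domination_number_ladder_graph_le by simp
  then have "potential n (last p) - potential n (hd p) \<le> int (vwalk_length p)"
    using assms(9) potential_reconf_step unfolding reconf_sequence_def
    by (intro vwalk_length_ge_potential_diff) auto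
  then show ?thesis
    using assms(5,8,9) by (simp add: reconf_sequence_def potential_S1 potential_S7)
qed

end
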